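(* Let $\omega=(-1+\sqrt{-3})/2$. For every positive integer $n$, $$\sum_{\substack{0\le k\le n\\ 6\mid k-3}}\binom nkB_{n-k}(x)=\frac n6\big(x^{n-1}+(x-1)^{n-1}-(x+\omega)^{n-1}-(x+\omega^2)^{n-1}\big).$$
   Context: The Bernoulli numbers $B_n$ are defined by $B_0=1$ and $\sum_{k=0}^{n-1}\binom nkB_k=0$ for $n\ge 2$; the Bernoulli polynomials are $B_n(x)=\sum_{k=0}^n\binom nkB_kx^{n-k}$ for $n\ge 0$. *)

theory Defs
  imports Complex_Main
begin

text \<open>
  The recursion is the identity
  \<open>(\<Sum>k<n. (n choose k) * B\<^sub>k) = 0\<close> (for \<open>n \<ge> 2\<close>) solved for its last term
  \<open>B\<^bsub>n-1\<^esub>\<close>, whose coefficient is \<open>n\<close>; the lemmas below recover this identity and show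
  that it, together with \<open>B\<^sub>0 = 1\<close>, determines the sequence.
\<close>

fun bernoulli :: "nat \<Rightarrow> real" where
  "bernoulli 0 = 1"
| "bernoulli (Suc m) =
     - (\<Sum>k\<in>{..<Suc m}. real (Suc (Suc m) choose k) * bernoulli k) / real (Suc (Suc m))"

declare bernoulli.simps(2) [simp del]

lemma bernoulli_sum_eq_0:
  assumes "n \<ge> 2"
  shows "(\<Sum>k=0..n-1. real (n choose k) * bernoulli k) = 0"
proof -
  obtain m where n: "n = Suc (Suc m)"
    using assms by (metis One_nat_def Suc_1 Suc_le_D Suc_le_mono)
  have "{0..n-1} = insert (Suc m) {..<Suc m}"
    unfolding n by auto
  moreover have "real (n choose Suc m) * bernoulli (Suc m)
      = - (\<Sum>k\<in>{..<Suc m}. real (n choose k) * bernoulli k)"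
    unfolding n bernoulli.simps(2) by (simp add: binomial_symmetric[of "Suc m"] field_simps del: binomial_Suc_Suc)
  ultimately show ?thesis
    by simp
qed

lemma bernoulli_unique:
  fixes b :: "nat \<Rightarrow> real"
  assumes "b 0 = 1"
    and rec: "\<And>n. n \<ge> 2 \<Longrightarrow> (\<Sum>k=0..n-1. real (n choose k) * b k) = 0"
  shows "b = bernoulli"
proof
  fix m show "b m = bernoulli m"
  proof (induction m rule: less_induct)
    case (less m)
    show ?case
    proof (cases m)
      case 0
      then show ?thesis using assms(1) by simp
    next
      case (Suc l)
      have s: "{0..Suc m - 1} = insert m {..<m}" by auto
      have "(\<Sum>k<m. real (Suc m choose k) * b k)
          = (\<Sum>k<m. real (Suc m choose k) * bernoulli k)"
        using less by (intro sum.cong) auto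
      moreover have "(\<Sum>k<m. real (Suc m choose k) * b k) + real (Suc m choose m) * b m = 0"
        using rec[of "Suc m"] Suc unfolding s by (simp del: binomial_Suc_Suc)
      moreover have "(\<Sum>k<m. real (Suc m choose k) * bernoulli k)
          + real (Suc m choose m) * bernoulli m = 0"
        using bernoulli_sum_eq_0[of "Suc m"] Suc unfolding s by (simp del: binomial_Suc_Suc)
      ultimately have "real (Suc m choose m) * b m = real (Suc m choose m) * bernoulli m"
        by linarith
      then show ?thesis by simp
    qed
  qed
qed

definition bernpoly :: "nat \<Rightarrow> 'a \<Rightarrow> 'a :: real_algebra_1" where
  "bernpoly n x = (\<Sum>k=0..n. of_nat (n choose k) * of_real (bernoulli k) * x ^ (n - k))"

end

theory Submission
  imports Defs "HOL-Computational_Algebra.Formal_Power_Series"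
begin

text \<open>
  The generating function \<open>\<Sum>\<^sub>n B\<^sub>n(x) t\<^sup>n / n! = t e\<^bsup>xt\<^esup> / (e\<^sup>t - 1)\<close> gives
  \<open>B\<^sub>n(x + y) = \<Sum>\<^sub>k (n choose k) B\<^bsub>n-k\<^esub>(x) y\<^sup>k\<close> and \<open>B\<^sub>n(x + 1) - B\<^sub>n(x) = n x\<^bsup>n-1\<^esup>\<close>.
  Taking for \<open>y\<close> the sixth roots of unity \<open>1, -\<omega>\<^sup>2, \<omega>, -1, \<omega>\<^sup>2, -\<omega>\<close> with alternating signs
  extracts the terms with \<open>k \<equiv> 3\<close> modulo 6. Since \<open>-\<omega>\<^sup>2 = \<omega> + 1\<close> and \<open>-\<omega> = \<omega>\<^sup>2 + 1\<close>,
  the six values of \<open>B\<^sub>n\<close> then pair up into unit differences.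
\<close>

unbundle fps_syntax

definition bernoulli_fps :: "'a :: {field_char_0, real_algebra_1} fps" where
  "bernoulli_fps = Abs_fps (\<lambda>n. of_real (bernoulli n) / fact n)"

definition bernpoly_fps :: "'a \<Rightarrow> 'a :: {field_char_0, real_algebra_1} fps" where
  "bernpoly_fps x = Abs_fps (\<lambda>n. bernpoly n x / fact n)"

text \<open>Since \<open>e^t - 1\<close> has no constant term, \<open>B_n\<close> drops out of the
  \<open>n\<close>-th coefficient of the product, which leaves the sum of the defining recursion
  divided by \<open>fact n\<close>.\<close>

lemma bernoulli_fps_mult_exp:
  "bernoulli_fps * (fps_exp 1 - 1) = (fps_X :: 'a :: {field_char_0, real_algebra_1} fps)"
proof (rule fps_ext)
  fix n :: nat
  let ?b = "\<lambda>k. of_real (bernoulli k) :: 'a"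
  have "(bernoulli_fps * (fps_exp 1 - 1)) $ n
      = (\<Sum>k=0..n. ?b k / fact k * (1 / fact (n - k) - (if n = k then 1 else 0)))"
    by (simp add: fps_mult_nth bernoulli_fps_def)
  also have "\<dots> = (\<Sum>k<n. ?b k / fact k * (1 / fact (n - k)))"
    by (intro sum.mono_neutral_cong_right) auto
  also have "\<dots> = (\<Sum>k<n. of_nat (n choose k) * ?b k) / fact n"
    unfolding sum_divide_distrib
    by (intro sum.cong) (auto simp: binomial_fact field_simps)
  \<comment> \<open>The recursion gives 0 only from \<open>n = 2\<close> on. For
    \<open>n = 0\<close> the sum is empty, and for \<open>n = 1\<close> it is
    \<open>B_0 = 1\<close>, the single nonzero coefficient of \<open>fps_X\<close>.\<close>
  also have "(\<Sum>k<n. of_nat (n choose k) * ?b k) = of_nat n * fps_X $ n"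
  proof (cases "n \<ge> 2")
    case True
    then have "{0..n-1} = {..<n}"
      by auto
    with bernoulli_sum_eq_0[OF True] have "of_real (\<Sum>k<n. real (n choose k) * bernoulli k) = (0 :: 'a)"
      by simp
    with True show ?thesis
      by simp
  next
    case False
    then have "n = 0 \<or> n = 1"
      by auto
    then show ?thesis
      by auto
  qed
  also have "of_nat n * fps_X $ n / fact n = (fps_X $ n :: 'a)"
    by simp
  finally show "(bernoulli_fps * (fps_exp 1 - 1)) $ n = (fps_X $ n :: 'a)" .
qed

lemma bernpoly_fps_eq: "bernpoly_fps x = bernoulli_fps * fps_exp x"
proof (rule fps_ext)
  fix n
  show "bernpoly_fps x $ n = (bernoulli_fps * fps_exp x) $ n"
    unfolding bernpoly_fps_def bernpoly_def bernoulli_fps_def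
    by (simp add: fps_mult_nth sum_divide_distrib)
      (intro sum.cong, auto simp: binomial_fact field_simps)
qed

text \<open>Compare coefficients in \<open>e^((x+y)t) = e^(yt) e^(xt)\<close> after multiplying by
  the Bernoulli series.\<close>

lemma bernpoly_add:
  fixes x y :: "'a :: {field_char_0, real_algebra_1}"
  shows "bernpoly n (x + y) = (\<Sum>k=0..n. of_nat (n choose k) * bernpoly (n - k) x * y ^ k)"
proof -
  have "bernpoly_fps (x + y) = fps_exp y * bernpoly_fps x"
    by (simp add: bernpoly_fps_eq fps_exp_add_mult mult_ac)
  then have "bernpoly_fps (x + y) $ n = (fps_exp y * bernpoly_fps x) $ n"
    by simp
  then have "bernpoly n (x + y)
      = fact n * (\<Sum>k=0..n. y ^ k / fact k * (bernpoly (n - k) x / fact (n - k)))"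
    by (simp add: bernpoly_fps_def fps_mult_nth field_simps)
  also have "\<dots> = (\<Sum>k=0..n. of_nat (n choose k) * bernpoly (n - k) x * y ^ k)"
    unfolding sum_distrib_left by (intro sum.cong) (auto simp: binomial_fact field_simps)
  finally show ?thesis .
qed

text \<open>Passing from \<open>x\<close> to \<open>x + 1\<close> multiplies the generating function
  by \<open>e^t\<close>, so the difference carries the factor \<open>e^t - 1\<close>, which cancels
  the denominator and leaves \<open>t e^(xt)\<close>.\<close>

lemma bernpoly_diff:
  fixes x :: "'a :: {field_char_0, real_algebra_1}"
  shows "bernpoly n (x + 1) - bernpoly n x = of_nat n * x ^ (n - 1)"
proof -
  have "bernpoly_fps (x + 1) - bernpoly_fps x = bernoulli_fps * (fps_exp 1 - 1) * fps_exp x"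
    by (simp add: bernpoly_fps_eq fps_exp_add_mult algebra_simps)
  also have "\<dots> = fps_X * fps_exp x"
    by (simp add: bernoulli_fps_mult_exp)
  finally have "(bernpoly_fps (x + 1) - bernpoly_fps x) $ n = (fps_X * fps_exp x) $ n"
    by simp
  then have "bernpoly n (x + 1) - bernpoly n x = fact n * (fps_X * fps_exp x) $ n"
    by (simp add: bernpoly_fps_def divide_simps mult_ac flip: diff_divide_distrib split: if_splits)
  also have "\<dots> = of_nat n * x ^ (n - 1)"
  proof (cases n)
    case (Suc m)
    have "fact (Suc m) * (x ^ m / fact m) = of_nat (Suc m) * x ^ m"
      by (simp only: fact_Suc) simp
    with Suc show ?thesis
      by simp
  qed simp
  finally show ?thesis .
qed

text \<open>The left side factors as \<open>(1 - (-1)^k) (1 + w^k + w^(2k))\<close>. The first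
  factor is 2 for odd \<open>k\<close> and 0 otherwise; the second is 3 if 3 divides
  \<open>k\<close> and 0 otherwise.\<close>

lemma sixth_roots_filter:
  fixes w :: "'a :: comm_ring_1"
  assumes w: "w\<^sup>2 = - 1 - w"
  shows "1 - (1 + w) ^ k + w ^ k - (- 1) ^ k + (w\<^sup>2) ^ k - (1 + w\<^sup>2) ^ k
    = (if k mod 6 = 3 then 6 else 0)"
proof -
  have w3: "w ^ 3 = 1"
  proof -
    have "w ^ 3 = w * w\<^sup>2"
      by (simp add: power3_eq_cube power2_eq_square)
    also have "\<dots> = - w - w\<^sup>2"
      by (simp add: w power2_eq_square[symmetric] right_diff_distrib)
    finally show ?thesis
      by (simp add: w)
  qed
  have "1 + w = - (w ^ 2)" "1 + w\<^sup>2 = - w"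
    using w by simp_all
  then have "1 - (1 + w) ^ k + w ^ k - (- 1) ^ k + (w\<^sup>2) ^ k - (1 + w\<^sup>2) ^ k
      = (1 - (- 1) ^ k) * (1 + w ^ k + (w ^ k)\<^sup>2)"
    by (simp add: power_minus[of w] power_minus[of "w\<^sup>2"] algebra_simps
        flip: power_mult)
  also have "\<dots> = (if k mod 6 = 3 then 6 else 0)"
  proof -
    have k: "k = 3 * (k div 3) + k mod 3"
      by simp
    have wk: "w ^ k = w ^ (k mod 3)"
      by (subst k) (simp only: power_add power_mult w3 power_one mult_1_left)
    have "k mod 3 = 0 \<or> k mod 3 = 1 \<or> k mod 3 = 2"
      by linarith
    \<comment> \<open>This makes the second factor vanish when \<open>k mod 3 = 2\<close>; for
      \<open>k mod 3 = 1\<close> the assumption \<open>w\<close> suffices.\<close>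
    moreover have "1 + w\<^sup>2 + (w\<^sup>2)\<^sup>2 = 0"
    proof -
      have "(w\<^sup>2)\<^sup>2 = w ^ 3 * w"
        by (simp add: power2_eq_square power3_eq_cube mult_ac)
      with w w3 show ?thesis
        by simp
    qed
    moreover have "k mod 6 = 3 \<longleftrightarrow> k mod 3 = 0 \<and> odd k"
      by presburger
    ultimately show ?thesis
      using w by (auto simp: wk)
  qed
  finally show ?thesis .
qed

theorem theorem2p1:
  fixes n :: nat and x \<omega> :: complex
  defines "\<omega> \<equiv> (-1 + csqrt (-3)) / 2"
  assumes "n > 0"
  shows "(\<Sum>k | 0 \<le> k \<and> k \<le> n \<and> 6 dvd (int k - 3). of_nat (n choose k) * bernpoly (n - k) x)
    = of_nat n / 6 * (x ^ (n - 1) + (x - 1) ^ (n - 1) - (x + \<omega>) ^ (n - 1) - (x + \<omega>\<^sup>2) ^ (n - 1))"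
proof -
  let ?B = "bernpoly n :: complex \<Rightarrow> complex"
  let ?c = "\<lambda>k. of_nat (n choose k) * bernpoly (n - k) x"
  have w: "\<omega>\<^sup>2 = - 1 - \<omega>"
  proof -
    have "(csqrt (-3))\<^sup>2 = -3"
      by (rule power2_csqrt)
    then show ?thesis
      by (simp add: \<omega>_def power2_eq_square field_simps)
  qed
  \<comment> \<open>The difference is taken in the integers: truncated subtraction would wrongly
    admit \<open>k = 0\<close>.\<close>
  have set_eq: "{k. 0 \<le> k \<and> k \<le> n \<and> 6 dvd (int k - 3)} = {k \<in> {0..n}. k mod 6 = 3}"
    by (auto; presburger)
  have "6 * (\<Sum>k | 0 \<le> k \<and> k \<le> n \<and> 6 dvd (int k - 3). ?c k)
      = (\<Sum>k=0..n. ?c k * (if k mod 6 = 3 then 6 else 0))"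
    unfolding set_eq sum_distrib_left sum.inter_filter[OF finite_atLeastAtMost]
    by (intro sum.cong) auto
  also have "\<dots> = (\<Sum>k=0..n. ?c k * 1 ^ k - ?c k * (1 + \<omega>) ^ k + ?c k * \<omega> ^ k
      - ?c k * (- 1) ^ k + ?c k * (\<omega>\<^sup>2) ^ k - ?c k * (1 + \<omega>\<^sup>2) ^ k)"
    by (intro sum.cong refl, subst sixth_roots_filter[OF w, symmetric]) (simp only: power_one ring_distribs mult_1_right)
  also have "\<dots> = ?B (x + 1) - ?B (x + (1 + \<omega>)) + ?B (x + \<omega>) - ?B (x + - 1)
      + ?B (x + \<omega>\<^sup>2) - ?B (x + (1 + \<omega>\<^sup>2))"
    by (simp only: bernpoly_add sum.distrib sum_subtractf)
  \<comment> \<open>The term \<open>?B x\<close> is inserted and cancels against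
    \<open>?B (x - 1 + 1)\<close>, so that all four brackets are unit differences.\<close>
  also have "\<dots> = (?B (x + 1) - ?B x) + (?B (x - 1 + 1) - ?B (x - 1))
      - (?B (x + \<omega> + 1) - ?B (x + \<omega>)) - (?B (x + \<omega>\<^sup>2 + 1) - ?B (x + \<omega>\<^sup>2))"
    by (simp add: add_ac)
  also have "\<dots> = of_nat n * (x ^ (n - 1) + (x - 1) ^ (n - 1)
      - (x + \<omega>) ^ (n - 1) - (x + \<omega>\<^sup>2) ^ (n - 1))"
    by (simp only: bernpoly_diff ring_distribs)
  finally show ?thesis
    by (simp add: field_simps)
qed

end
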